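(* Every algebraic unit is an eigenvalue of some integral symplectic matrix: for every algebraic unit $\lambda\in\mathbb{C}$ there exist $g\ge 1$ and a $2g\times 2g$ integer matrix $A$ with $A^TJA=J$ such that $\lambda$ is an eigenvalue of $A$.
   Context: An algebraic unit is a root of a monic polynomial with integer coefficients, irreducible over the integers, with constant term $\pm 1$. $J$ denotes the standard symplectic form on $\mathbb{R}^{2g}$ given by the block-diagonal matrix with $g$ diagonal blocks $\begin{pmatrix}0&1\\-1&0\end{pmatrix}$. *)

theory Defs
  imports "Jordan_Normal_Form.Char_Poly"
begin

definition algebraic_unit :: "complex \<Rightarrow> bool" where
  "algebraic_unit z \<longleftrightarrow>
     (\<exists>p :: int poly. lead_coeff p = 1 \<and> irreducible p \<and> (coeff p 0 = 1 \<or> coeff p 0 = -1) \<and>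
        poly (map_poly of_int p) z = 0)"

definition symplectic_J :: "nat \<Rightarrow> 'a :: comm_ring_1 mat" where
  "symplectic_J g = diag_block_mat (replicate g (mat_of_rows_list 2 [[0, 1], [-1, 0]]))"

lemma symplectic_J_carrier: "symplectic_J g \<in> carrier_mat (2 * g) (2 * g)"
  unfolding symplectic_J_def
  by (intro carrier_matI)
     (simp_all add: dim_diag_block_mat map_replicate sum_list_replicate mat_of_rows_list_def)

(* An integral matrix preserves J over the reals iff it does over the integers, as J is integral. *)
definition integral_symplectic :: "nat \<Rightarrow> int mat \<Rightarrow> bool" where
  "integral_symplectic g A \<longleftrightarrow>
     A \<in> carrier_mat (2 * g) (2 * g) \<and>
     transpose_mat A * symplectic_J g * A = symplectic_J g"

end

theory Submission
  imports Defs
begin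

text \<open>If \<open>C\<close> is an invertible integer matrix, then \<open>C\<close> acting on one Lagrangian subspace and its
  inverse transpose acting on the dual one together preserve the symplectic form, and every
  eigenvalue of \<open>C\<close> is an eigenvalue of the result. For \<open>C\<close> take the companion matrix of the
  polynomial of the unit: its constant term is \<open>\<plusminus>1\<close>, so it is invertible over the integers.\<close>

lemma sum_lessThan_double:
  fixes f :: "nat \<Rightarrow> 'a :: comm_monoid_add"
  shows "(\<Sum>k\<in>{0..<2 * n}. f k) = (\<Sum>i\<in>{0..<n}. f (2 * i) + f (2 * i + 1))"
  by (induction n) (simp_all add: add.assoc)

lemma symplectic_J_index:
  assumes "r < 2 * g" "c < 2 * g"
  shows "symplectic_J g $$ (r, c) =
    (if even r \<and> c = r + 1 then 1 else if odd r \<and> r = c + 1 then -1 else 0)"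
  using assms
proof (induction g arbitrary: r c)
  case 0
  then show ?case by simp
next
  case (Suc g)
  define B :: "'a mat" where "B = mat_of_rows_list 2 [[0, 1], [-1, 0]]"
  have B: "dim_row B = 2" "dim_col B = 2"
    by (simp_all add: B_def mat_of_rows_list_def)
  have J: "symplectic_J (Suc g) =
      four_block_mat B (0\<^sub>m 2 (2 * g)) (0\<^sub>m (2 * g) 2) (symplectic_J g)"
    using symplectic_J_carrier[of g, where ?'a = 'a] B
    by (simp add: symplectic_J_def B_def[symmetric] Let_def)
  have dims: "dim_row (symplectic_J g :: 'a mat) = 2 * g" "dim_col (symplectic_J g :: 'a mat) = 2 * g"
    using symplectic_J_carrier[of g, where ?'a = 'a] by auto
  consider (old) "r < 2" "c < 2" | (r) "r < 2" "c \<ge> 2" | (c) "r \<ge> 2" "c < 2" | (new) "r \<ge> 2" "c \<ge> 2"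
    by linarith
  then show ?case
  proof cases
    case old
    then have "r = 0 \<or> r = 1" "c = 0 \<or> c = 1" by auto
    then show ?thesis
      by (auto simp: J B dims) (simp_all add: B_def mat_of_rows_list_def)
  next
    case r
    then have "r = 0 \<or> r = 1" by auto
    with r show ?thesis using Suc.prems by (auto simp: J B dims)
  next
    case c
    then have "c = 0 \<or> c = 1" by auto
    with c show ?thesis using Suc.prems by (auto simp: J B dims)
  next
    case new
    \<comment> \<open>Dropping the first block shifts both indices by 2, which keeps their parity
      and their difference, so the induction hypothesis transfers directly.\<close>
    then obtain r' c' where "r = r' + 2" "c = c' + 2"
      by (metis add.commute le_Suc_ex)
    with Suc.prems Suc.IH[of r' c'] show ?thesis by (auto simp: J B dims)
  qed
qed

text \<open>Row \<open>k\<close> of \<open>symplectic_J g\<close> has a single nonzero entry, in the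
  column \<open>s\<close> paired with \<open>k\<close> in its block, so the sum collapses to one
  term.\<close>

lemma symplectic_J_mult_index:
  assumes A: "A \<in> carrier_mat (2 * g) m" and k: "k < 2 * g" and c: "c < m"
  shows "(symplectic_J g * A) $$ (k, c) =
    (if even k then A $$ (k + 1, c) else - A $$ (k - 1, c))"
proof -
  define s where "s = (if even k then k + 1 else k - 1)"
  have s: "s < 2 * g"
    using k by (auto simp: s_def elim!: evenE)
  have "(symplectic_J g * A) $$ (k, c) = (\<Sum>l\<in>{0..<2 * g}. symplectic_J g $$ (k, l) * A $$ (l, c))"
    using A k c symplectic_J_carrier[of g, where ?'a = 'a] by (auto simp: scalar_prod_def)
  also have "\<dots> = (\<Sum>l\<in>{0..<2 * g}. if l = s then (if even k then 1 else -1) * A $$ (l, c) else 0)"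
    using k by (intro sum.cong refl) (auto simp: symplectic_J_index s_def elim: oddE)
  also have "\<dots> = (if even k then 1 else -1) * A $$ (s, c)"
    using s by simp
  finally show ?thesis by (simp add: s_def)
qed

text \<open>The even and the odd coordinates span the two Lagrangian subspaces of \<open>symplectic_J\<close>.\<close>

definition interleave_mat :: "nat \<Rightarrow> 'a :: zero mat \<Rightarrow> 'a mat \<Rightarrow> 'a mat" where
  "interleave_mat n C E = mat (2 * n) (2 * n) (\<lambda>(r, c).
     if even r \<and> even c then C $$ (r div 2, c div 2)
     else if odd r \<and> odd c then E $$ (r div 2, c div 2) else 0)"

lemma interleave_mat_carrier: "interleave_mat n C E \<in> carrier_mat (2 * n) (2 * n)"
  by (simp add: interleave_mat_def)

lemma interleave_mat_index:
  assumes "i < n" "j < n"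
  shows "interleave_mat n C E $$ (2 * i, 2 * j) = C $$ (i, j)"
    "interleave_mat n C E $$ (Suc (2 * i), Suc (2 * j)) = E $$ (i, j)"
    "interleave_mat n C E $$ (2 * i, Suc (2 * j)) = 0"
    "interleave_mat n C E $$ (Suc (2 * i), 2 * j) = 0"
  using assms by (simp_all add: interleave_mat_def)

text \<open>With coordinates sorted by parity, \<open>A\<close> becomes \<open>diag(C, E)\<close>
  and the form becomes \<open>[[0, 1], [-1, 0]]\<close> in blocks of size \<open>n\<close>. Hence
  the off-diagonal blocks of \<open>A^T J A\<close> are \<open>C^T E\<close> and
  \<open>- E^T C\<close>, while its diagonal blocks vanish.\<close>

lemma integral_symplectic_interleave_mat:
  assumes C: "C \<in> carrier_mat n n" and E: "E \<in> carrier_mat n n"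
    and EC: "transpose_mat E * C = 1\<^sub>m n"
  shows "integral_symplectic n (interleave_mat n C E)"
proof -
  define A where "A = interleave_mat n C E"
  have A: "A \<in> carrier_mat (2 * n) (2 * n)"
    by (simp add: A_def interleave_mat_carrier)
  have J: "(symplectic_J n :: int mat) \<in> carrier_mat (2 * n) (2 * n)"
    by (rule symplectic_J_carrier)
  have EC': "(\<Sum>i\<in>{0..<n}. E $$ (i, a) * C $$ (i, b)) = (if a = b then 1 else 0)"
    if "a < n" "b < n" for a b
  proof -
    have "(transpose_mat E * C) $$ (a, b) = (\<Sum>i\<in>{0..<n}. E $$ (i, a) * C $$ (i, b))"
      using that C E by (auto simp: scalar_prod_def)
    then show ?thesis using that by (simp add: EC)
  qed
  \<comment> \<open>This is \<open>C^T E = 1\<close>, the transpose of the hypothesis; it settles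
    the entries with \<open>r\<close> even and \<open>c\<close> odd.\<close>
  then have CE: "(\<Sum>i\<in>{0..<n}. C $$ (i, b) * E $$ (i, a)) = (if a = b then 1 else 0)"
    if "a < n" "b < n" for a b
    using that by (simp add: mult.commute)
  have "transpose_mat A * symplectic_J n * A = symplectic_J n"
  proof (rule eq_matI)
    fix r c assume "r < dim_row (symplectic_J n :: int mat)" "c < dim_col (symplectic_J n :: int mat)"
    then have rc: "r < 2 * n" "c < 2 * n" using J by auto
    have "(transpose_mat A * symplectic_J n * A) $$ (r, c) =
        (transpose_mat A * (symplectic_J n * A)) $$ (r, c)"
      using A J by (subst assoc_mult_mat) auto
    also have "\<dots> = (\<Sum>k\<in>{0..<2 * n}. A $$ (k, r) * (symplectic_J n * A) $$ (k, c))"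
      using A J rc by (auto simp: scalar_prod_def)
    also have "\<dots> = (\<Sum>k\<in>{0..<2 * n}.
        A $$ (k, r) * (if even k then A $$ (k + 1, c) else - A $$ (k - 1, c)))"
      using A rc by (intro sum.cong refl) (simp add: symplectic_J_mult_index del: index_mult_mat(1))
    also have "\<dots> = (\<Sum>i\<in>{0..<n}. A $$ (2 * i, r) * A $$ (Suc (2 * i), c)
        - A $$ (Suc (2 * i), r) * A $$ (2 * i, c))"
      by (simp add: sum_lessThan_double)
    also have "\<dots> = symplectic_J n $$ (r, c)"
    proof -
      obtain a b where ab: "r = 2 * a \<or> r = Suc (2 * a)" "c = 2 * b \<or> c = Suc (2 * b)"
        by (metis evenE oddE Suc_eq_plus1)
      then have lt: "a < n" "b < n" using rc by auto
      \<comment> \<open>These show that \<open>symplectic_J n\<close> vanishes where both indices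
        have the same parity.\<close>
      have parity: "2 * a \<noteq> Suc (2 * b)" "2 * b \<noteq> Suc (2 * a)" by presburger+
      from ab show ?thesis
        using lt rc EC'[of a b] CE[of b a] parity
        by (elim disjE)
          (auto simp: A_def interleave_mat_index symplectic_J_index sum_negf)
    qed
    finally show "(transpose_mat A * symplectic_J n * A) $$ (r, c) = symplectic_J n $$ (r, c)" .
  qed (use A J in auto)
  with A show ?thesis
    by (simp add: integral_symplectic_def A_def)
qed

text \<open>An eigenvector \<open>w\<close> of \<open>C\<close> is placed on the even coordinates
  and padded with zeros on the odd ones. The map \<open>h\<close> carries the entries into the
  field, and \<open>h 0 = 0\<close> keeps the even subspace invariant.\<close>

lemma eigenvalue_interleave_mat:
  fixes C :: "'a :: ring_1 mat" and w :: "nat \<Rightarrow> 'b :: field" and h :: "'a \<Rightarrow> 'b"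
  assumes h: "h 0 = 0"
    and eig: "\<And>i. i < n \<Longrightarrow> (\<Sum>j\<in>{0..<n}. h (C $$ (i, j)) * w j) = z * w i"
    and w: "k < n" "w k \<noteq> 0"
  shows "eigenvalue (map_mat h (interleave_mat n C E)) z"
proof -
  define A where "A = map_mat h (interleave_mat n C E)"
  define v where "v = vec (2 * n) (\<lambda>r. if even r then w (r div 2) else 0)"
  have A: "A \<in> carrier_mat (2 * n) (2 * n)"
    by (simp add: A_def interleave_mat_carrier)
  have ix: "A $$ (r, c) = h (interleave_mat n C E $$ (r, c))" if "r < 2 * n" "c < 2 * n" for r c
    using that interleave_mat_carrier[of n C E] by (simp add: A_def)
  have "A *\<^sub>v v = z \<cdot>\<^sub>v v"
  proof (rule eq_vecI)
    fix r assume "r < dim_vec (z \<cdot>\<^sub>v v)"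
    then have r: "r < 2 * n" by (simp add: v_def)
    then have "(A *\<^sub>v v) $ r = (\<Sum>c\<in>{0..<2 * n}. A $$ (r, c) * v $ c)"
      using A by (auto simp: scalar_prod_def v_def)
    also have "\<dots> = (\<Sum>j\<in>{0..<n}. h (interleave_mat n C E $$ (r, 2 * j)) * w j)"
      unfolding sum_lessThan_double using r
      by (intro sum.cong refl) (simp add: v_def ix)
    also have "\<dots> = (z \<cdot>\<^sub>v v) $ r"
    proof -
      obtain i where i: "r = 2 * i \<or> r = Suc (2 * i)" by (metis evenE oddE Suc_eq_plus1)
      then show ?thesis
        using r eig[of i] by (auto simp: interleave_mat_index v_def h)
    qed
    finally show "(A *\<^sub>v v) $ r = (z \<cdot>\<^sub>v v) $ r" .
  qed (use A in \<open>auto simp: v_def\<close>)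
  moreover have "v \<noteq> 0\<^sub>v (2 * n)"
  proof
    assume "v = 0\<^sub>v (2 * n)"
    then have "v $ (2 * k) = 0" using w by simp
    with w show False by (simp add: v_def)
  qed
  ultimately have "eigenvector A v z"
    using A by (simp add: eigenvector_def v_def)
  then show ?thesis by (auto simp: eigenvalue_def A_def)
qed

text \<open>The transposed companion matrix, for which \<open>(1, z, \<dots>, z^(n-1))\<close> is an eigenvector, and its
  inverse transpose: the entries \<open>- a\<^sub>0 a\<^sub>i\<^sub>+\<^sub>1\<close> come from solving \<open>p z = 0\<close> for \<open>1 / z\<close>, with
  \<open>1 / a\<^sub>0 = a\<^sub>0\<close>.\<close>

definition row_companion_mat :: "'a :: comm_ring_1 poly \<Rightarrow> 'a mat" where
  "row_companion_mat p = mat (degree p) (degree p) (\<lambda>(i, j).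
     if Suc i = degree p then - coeff p j else if j = Suc i then 1 else 0)"

definition row_companion_inv_transpose :: "'a :: comm_ring_1 poly \<Rightarrow> 'a mat" where
  "row_companion_inv_transpose p = mat (degree p) (degree p) (\<lambda>(i, j).
     if j = 0 then - coeff p 0 * coeff p (Suc i) else if j = Suc i then 1 else 0)"

lemma row_companion_inv_transpose:
  assumes monic: "lead_coeff p = 1" and const: "coeff p 0 * coeff p 0 = 1"
  shows "transpose_mat (row_companion_inv_transpose p) * row_companion_mat p = 1\<^sub>m (degree p)"
proof (rule eq_matI)
  fix a b assume "a < dim_row (1\<^sub>m (degree p) :: 'a mat)" "b < dim_col (1\<^sub>m (degree p) :: 'a mat)"
  then have ab: "a < degree p" "b < degree p" by auto
  then obtain m where m: "degree p = Suc m" by (cases "degree p") auto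
  let ?E = "row_companion_inv_transpose p" and ?C = "row_companion_mat p"
  have "(transpose_mat ?E * ?C) $$ (a, b) = (\<Sum>i\<in>{0..<Suc m}. ?E $$ (i, a) * ?C $$ (i, b))"
    using ab by (auto simp: scalar_prod_def row_companion_mat_def row_companion_inv_transpose_def m)
  also have "\<dots> = (if a = b then 1 else 0)"
  proof (cases "a = 0")
    case True
    \<comment> \<open>The last row contributes \<open>(- coeff p 0) * (- coeff p b)\<close>, as
      \<open>p\<close> is monic. This cancels the superdiagonal term when \<open>b > 0\<close> and
      leaves the square of \<open>coeff p 0\<close> when \<open>b = 0\<close>.\<close>
    have "(\<Sum>i\<in>{0..<Suc m}. ?E $$ (i, a) * ?C $$ (i, b)) =
        (\<Sum>i\<in>{0..<m}. if b = Suc i then - coeff p 0 * coeff p b else 0) + coeff p 0 * coeff p b"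
      using ab monic True
      by (simp add: row_companion_mat_def row_companion_inv_transpose_def m)
        (intro sum.cong, auto)
    also have "\<dots> = (if a = b then 1 else 0)"
      using ab True const m by (cases b) simp_all
    finally show ?thesis .
  next
    case False
    then obtain a' where a': "a = Suc a'" by (cases a) auto
    \<comment> \<open>Column \<open>a\<close> of \<open>?E\<close> is a unit vector that selects row
      \<open>a'\<close> of \<open>?C\<close>; that row is not the last one, so its only nonzero
      entry is a 1 in column \<open>a\<close>.\<close>
    have "(\<Sum>i\<in>{0..<Suc m}. ?E $$ (i, a) * ?C $$ (i, b)) =
        (\<Sum>i\<in>{0..<Suc m}. if i = a' then (if a = b then 1 else 0) else 0)"
      using ab by (intro sum.cong refl)
        (auto simp: row_companion_mat_def row_companion_inv_transpose_def m a')
    then show ?thesis using ab by (simp add: m a')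
  qed
  finally show "(transpose_mat ?E * ?C) $$ (a, b) = 1\<^sub>m (degree p) $$ (a, b)"
    using ab by simp
qed (simp_all add: row_companion_mat_def row_companion_inv_transpose_def)

text \<open>Every row but the last shifts the powers of \<open>z\<close> by one; the last row
  encodes \<open>p z = 0\<close> solved for the top power.\<close>

lemma row_companion_mat_powers:
  fixes z :: "'a :: {comm_ring_1, ring_char_0}"
  assumes monic: "lead_coeff p = 1" and root: "poly (map_poly of_int p) z = 0"
    and i: "i < degree p"
  shows "(\<Sum>j\<in>{0..<degree p}. of_int (row_companion_mat p $$ (i, j)) * z ^ j) = z * z ^ i"
proof (cases "Suc i = degree p")
  case True
  have "0 = (\<Sum>j\<le>degree p. of_int (coeff p j) * z ^ j)"
    using root by (simp add: poly_altdef coeff_map_poly degree_map_poly)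
  also have "\<dots> = (\<Sum>j\<in>{0..<degree p}. of_int (coeff p j) * z ^ j) + z ^ degree p"
    using monic by (simp add: lessThan_Suc_atMost[symmetric] atLeast0LessThan)
  finally have "z ^ degree p = - (\<Sum>j\<in>{0..<degree p}. of_int (coeff p j) * z ^ j)"
    by (simp add: eq_neg_iff_add_eq_0 add.commute)
  then show ?thesis
    using True i by (simp add: row_companion_mat_def sum_negf flip: power_Suc)
next
  case False
  have "(\<Sum>j\<in>{0..<degree p}. of_int (row_companion_mat p $$ (i, j)) * z ^ j) =
      (\<Sum>j\<in>{0..<degree p}. if j = Suc i then z ^ j else 0)"
    using False i by (intro sum.cong refl) (simp add: row_companion_mat_def)
  then show ?thesis using False i by simp
qed

theorem theorem3:
  fixes z :: complex
  assumes "algebraic_unit z"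
  shows "\<exists>(g :: nat) (A :: int mat). g \<ge> 1 \<and> integral_symplectic g A \<and>
           eigenvalue (map_mat of_int A) z"
proof -
  from assms obtain p :: "int poly" where p: "lead_coeff p = 1"
      "coeff p 0 = 1 \<or> coeff p 0 = -1" "poly (map_poly of_int p) z = 0"
    by (auto simp: algebraic_unit_def)
  \<comment> \<open>A monic constant is 1 and has no root. Positive degree gives
    \<open>g \<ge> 1\<close> and makes coordinate 0 available below.\<close>
  have deg: "degree p > 0"
  proof (rule ccontr)
    assume "\<not> degree p > 0"
    then obtain c where "p = [:c:]" by (auto elim: degree_eq_zeroE)
    with p show False by (simp add: map_poly_pCons)
  qed
  let ?C = "row_companion_mat p" and ?E = "row_companion_inv_transpose p"
  let ?A = "interleave_mat (degree p) ?C ?E"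
  have "integral_symplectic (degree p) ?A"
    using p by (intro integral_symplectic_interleave_mat row_companion_inv_transpose)
      (auto simp: row_companion_mat_def row_companion_inv_transpose_def)
  moreover have "eigenvalue (map_mat of_int ?A) z"
    using p deg
    \<comment> \<open>Coordinate 0 witnesses that the eigenvector is nonzero, since
      \<open>z ^ 0 = 1\<close>.\<close>
    by (intro eigenvalue_interleave_mat[where k = 0 and w = "\<lambda>i. z ^ i"] row_companion_mat_powers)
      auto
  ultimately show ?thesis using deg by (auto simp: Suc_le_eq)
qed

end
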